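(* Let $\mathscr{C}$ be a semi-monoidal category and let $*$ be the terminal category with its unique semi-monoidal structure. A Saavedra unit in $\mathscr{C}$ is the same thing as a gentle, strong multiplicative functor $*\to\mathscr{C}$: the assignment sending a gentle strong multiplicative functor $(\eta,\phi_2):*\to\mathscr{C}$ to the object $I:=\eta( * )$ equipped with the arrow $\alpha:=\phi_{*,*}:II\to I$ is a bijection from gentle strong multiplicative functors $*\to\mathscr{C}$ to Saavedra units in $\mathscr{C}$.
   Context: A semi-monoidal category is a category with a strictly associative functor $\otimes:\mathscr{C}\times\mathscr{C}\to\mathscr{C}$, written as juxtaposition. An object $I$ is cancellable if the functors $X\mapsto IX$ and $X\mapsto XI$ are both fully faithful. A Saavedra unit is a pair $(I,\alpha)$ where $I$ is cancellable and $\alpha: II\to I$ is an isomorphism (no associativity of $\alpha$ is required). A strong multiplicative functor $(F,\phi_2):\mathscr{A}\to\mathscr{C}$ between semi-monoidal categories is a functor $F$ with natural isomorphisms $\phi_{X,Y}:F(X)F(Y)\to F(XY)$ such that $\phi_{XY,Z}\circ(\phi_{X,Y}\otimes \mathrm{id}_{F(Z)})=\phi_{X,YZ}\circ(\mathrm{id}_{F(X)}\otimes\phi_{Y,Z})$. A functor $F:\mathscr{U}\to\mathscr{C}$ to a semi-monoidal category is gentle if the two functors $\mathscr{U}\times\mathscr{C}\xrightarrow{F\times \mathrm{id}}\mathscr{C}\times\mathscr{C}\xrightarrow{\otimes}\mathscr{C}$ and $\mathscr{C}\times\mathscr{U}\xrightarrow{\mathrm{id}\times F}\mathscr{C}\times\mathscr{C}\xrightarrow{\otimes}\mathscr{C}$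 are fully faithful. *)

theory Defs
  imports Main "HOL-Library.FuncSet"
begin

record ('o, 'm) cat =
  Obj :: "'o set"
  Arr :: "'m set"
  Dom :: "'m \<Rightarrow> 'o"
  Cod :: "'m \<Rightarrow> 'o"
  Id :: "'o \<Rightarrow> 'm"
  Comp :: "'m \<Rightarrow> 'm \<Rightarrow> 'm"  (infixr "\<cdot>\<index>" 65)

text \<open>Composition is written in the usual order: \<open>g \<cdot>\<^bsub>C\<^esub> f\<close> is \<open>g\<close> after \<open>f\<close>,
  and is meaningful only if \<open>Cod f = Dom g\<close>.\<close>

definition hom :: "('o, 'm, 'z) cat_scheme \<Rightarrow> 'o \<Rightarrow> 'o \<Rightarrow> 'm set" where
  "hom C X Y = {f \<in> Arr C. Dom C f = X \<and> Cod C f = Y}"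

locale category =
  fixes C :: "('o, 'm, 'z) cat_scheme" (structure)
  assumes dom_obj: "f \<in> Arr C \<Longrightarrow> Dom C f \<in> Obj C"
    and cod_obj: "f \<in> Arr C \<Longrightarrow> Cod C f \<in> Obj C"
    and id_hom: "X \<in> Obj C \<Longrightarrow> Id C X \<in> hom C X X"
    and comp_hom: "\<lbrakk>f \<in> hom C X Y; g \<in> hom C Y Z\<rbrakk> \<Longrightarrow> g \<cdot> f \<in> hom C X Z"
    and comp_id_right: "f \<in> hom C X Y \<Longrightarrow> f \<cdot> Id C X = f"
    and comp_id_left: "f \<in> hom C X Y \<Longrightarrow> Id C Y \<cdot> f = f"
    and comp_assoc: "\<lbrakk>f \<in> hom C W X; g \<in> hom C X Y; h \<in> hom C Y Z\<rbrakk>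
      \<Longrightarrow> (h \<cdot> g) \<cdot> f = h \<cdot> (g \<cdot> f)"

definition iso :: "('o, 'm, 'z) cat_scheme \<Rightarrow> 'm \<Rightarrow> 'o \<Rightarrow> 'o \<Rightarrow> bool" where
  "iso C f X Y \<longleftrightarrow> f \<in> hom C X Y \<and>
    (\<exists>g \<in> hom C Y X. g \<cdot>\<^bsub>C\<^esub> f = Id C X \<and> f \<cdot>\<^bsub>C\<^esub> g = Id C Y)"

definition prod_cat ::
  "('o, 'm, 'y) cat_scheme \<Rightarrow> ('p, 'n, 'z) cat_scheme \<Rightarrow> ('o \<times> 'p, 'm \<times> 'n) cat" where
  "prod_cat A B = \<lparr>
    Obj = Obj A \<times> Obj B,
    Arr = Arr A \<times> Arr B,
    Dom = map_prod (Dom A) (Dom B),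
    Cod = map_prod (Cod A) (Cod B),
    Id = map_prod (Id A) (Id B),
    Comp = (\<lambda>(g, g') (f, f'). (g \<cdot>\<^bsub>A\<^esub> f, g' \<cdot>\<^bsub>B\<^esub> f'))\<rparr>"

text \<open>Functors and natural transformations are extensional (\<open>undefined\<close> outside the objects and
  arrows of their source), so that HOL equality is equality of functors and of transformations;
  hence the restrictions in the constructions below.\<close>

record ('o, 'm, 'p, 'n) ftor =
  obmap :: "'o \<Rightarrow> 'p"
  armap :: "'m \<Rightarrow> 'n"

definition is_functor ::
  "('o, 'm, 'y) cat_scheme \<Rightarrow> ('p, 'n, 'z) cat_scheme \<Rightarrow> ('o, 'm, 'p, 'n) ftor \<Rightarrow> bool" where
  "is_functor A B F \<longleftrightarrow>
    obmap F \<in> Obj A \<rightarrow>\<^sub>E Obj B \<and>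
    armap F \<in> Arr A \<rightarrow>\<^sub>E Arr B \<and>
    (\<forall>X\<in>Obj A. \<forall>Y\<in>Obj A. \<forall>f\<in>hom A X Y. armap F f \<in> hom B (obmap F X) (obmap F Y)) \<and>
    (\<forall>X\<in>Obj A. armap F (Id A X) = Id B (obmap F X)) \<and>
    (\<forall>X\<in>Obj A. \<forall>Y\<in>Obj A. \<forall>Z\<in>Obj A. \<forall>f\<in>hom A X Y. \<forall>g\<in>hom A Y Z.
      armap F (g \<cdot>\<^bsub>A\<^esub> f) = armap F g \<cdot>\<^bsub>B\<^esub> armap F f)"

definition fully_faithful ::
  "('o, 'm, 'y) cat_scheme \<Rightarrow> ('p, 'n, 'z) cat_scheme \<Rightarrow> ('o, 'm, 'p, 'n) ftor \<Rightarrow> bool" where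
  "fully_faithful A B F \<longleftrightarrow> is_functor A B F \<and>
    (\<forall>X\<in>Obj A. \<forall>Y\<in>Obj A. bij_betw (armap F) (hom A X Y) (hom B (obmap F X) (obmap F Y)))"

definition id_ftor :: "('o, 'm, 'z) cat_scheme \<Rightarrow> ('o, 'm, 'o, 'm) ftor" where
  "id_ftor A = \<lparr>obmap = (\<lambda>X\<in>Obj A. X), armap = (\<lambda>f\<in>Arr A. f)\<rparr>"

text \<open>\<open>comp_ftor A G F\<close> is \<open>G\<close> after \<open>F\<close>, where \<open>A\<close> is the source of \<open>F\<close>.\<close>

definition comp_ftor ::
  "('o, 'm, 'z) cat_scheme \<Rightarrow> ('p, 'n, 'q, 'k) ftor \<Rightarrow> ('o, 'm, 'p, 'n) ftor \<Rightarrow> ('o, 'm, 'q, 'k) ftor"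
  where
  "comp_ftor A G F =
    \<lparr>obmap = compose (Obj A) (obmap G) (obmap F), armap = compose (Arr A) (armap G) (armap F)\<rparr>"

text \<open>\<open>A\<close> and \<open>B\<close> are the sources of \<open>F\<close> and \<open>G\<close>.\<close>

definition prod_ftor ::
  "('o, 'm, 'y) cat_scheme \<Rightarrow> ('p, 'n, 'z) cat_scheme \<Rightarrow>
   ('o, 'm, 'q, 'k) ftor \<Rightarrow> ('p, 'n, 'r, 'l) ftor \<Rightarrow> ('o \<times> 'p, 'm \<times> 'n, 'q \<times> 'r, 'k \<times> 'l) ftor"
  where
  "prod_ftor A B F G = \<lparr>
    obmap = restrict (map_prod (obmap F) (obmap G)) (Obj A \<times> Obj B),
    armap = restrict (map_prod (armap F) (armap G)) (Arr A \<times> Arr B)\<rparr>"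

definition natural_iso ::
  "('o, 'm, 'y) cat_scheme \<Rightarrow> ('p, 'n, 'z) cat_scheme \<Rightarrow>
   ('o, 'm, 'p, 'n) ftor \<Rightarrow> ('o, 'm, 'p, 'n) ftor \<Rightarrow> ('o \<Rightarrow> 'n) \<Rightarrow> bool" where
  "natural_iso A B F G \<tau> \<longleftrightarrow>
    is_functor A B F \<and> is_functor A B G \<and>
    \<tau> \<in> extensional (Obj A) \<and>
    (\<forall>X\<in>Obj A. iso B (\<tau> X) (obmap F X) (obmap G X)) \<and>
    (\<forall>X\<in>Obj A. \<forall>Y\<in>Obj A. \<forall>f\<in>hom A X Y.
      armap G f \<cdot>\<^bsub>B\<^esub> \<tau> X = \<tau> Y \<cdot>\<^bsub>B\<^esub> armap F f)"

record ('o, 'm) smcat = "('o, 'm) cat" +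
  Tensor :: "('o \<times> 'o, 'm \<times> 'm, 'o, 'm) ftor"

abbreviation tensor_obj :: "('o, 'm, 'z) smcat_scheme \<Rightarrow> 'o \<Rightarrow> 'o \<Rightarrow> 'o" (infixr "\<odot>\<index>" 70) where
  "X \<odot>\<^bsub>C\<^esub> Y \<equiv> obmap (Tensor C) (X, Y)"

abbreviation tensor_arr :: "('o, 'm, 'z) smcat_scheme \<Rightarrow> 'm \<Rightarrow> 'm \<Rightarrow> 'm" (infixr "\<otimes>\<index>" 70) where
  "f \<otimes>\<^bsub>C\<^esub> g \<equiv> armap (Tensor C) (f, g)"

locale semi_monoidal = category C
  for C :: "('o, 'm, 'z) smcat_scheme" (structure) +
  assumes tensor_functor: "is_functor (prod_cat C C) C (Tensor C)"
    and tensor_obj_assoc: "\<lbrakk>X \<in> Obj C; Y \<in> Obj C; Z \<in> Obj C\<rbrakk>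
      \<Longrightarrow> (X \<odot> Y) \<odot> Z = X \<odot> (Y \<odot> Z)"
    and tensor_arr_assoc: "\<lbrakk>f \<in> Arr C; g \<in> Arr C; h \<in> Arr C\<rbrakk>
      \<Longrightarrow> (f \<otimes> g) \<otimes> h = f \<otimes> (g \<otimes> h)"

definition left_tensor :: "('o, 'm, 'z) smcat_scheme \<Rightarrow> 'o \<Rightarrow> ('o, 'm, 'o, 'm) ftor" where
  "left_tensor C I =
    \<lparr>obmap = (\<lambda>X\<in>Obj C. I \<odot>\<^bsub>C\<^esub> X), armap = (\<lambda>f\<in>Arr C. Id C I \<otimes>\<^bsub>C\<^esub> f)\<rparr>"

definition right_tensor :: "('o, 'm, 'z) smcat_scheme \<Rightarrow> 'o \<Rightarrow> ('o, 'm, 'o, 'm) ftor" where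
  "right_tensor C I =
    \<lparr>obmap = (\<lambda>X\<in>Obj C. X \<odot>\<^bsub>C\<^esub> I), armap = (\<lambda>f\<in>Arr C. f \<otimes>\<^bsub>C\<^esub> Id C I)\<rparr>"

definition cancellable :: "('o, 'm, 'z) smcat_scheme \<Rightarrow> 'o \<Rightarrow> bool" where
  "cancellable C I \<longleftrightarrow> I \<in> Obj C \<and>
    fully_faithful C C (left_tensor C I) \<and> fully_faithful C C (right_tensor C I)"

definition saavedra_unit :: "('o, 'm, 'z) smcat_scheme \<Rightarrow> 'o \<Rightarrow> 'm \<Rightarrow> bool" where
  "saavedra_unit C I \<alpha> \<longleftrightarrow> cancellable C I \<and> iso C \<alpha> (I \<odot>\<^bsub>C\<^esub> I) I"

definition strong_multiplicative ::
  "('o, 'm, 'y) smcat_scheme \<Rightarrow> ('p, 'n, 'z) smcat_scheme \<Rightarrow>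
   ('o, 'm, 'p, 'n) ftor \<Rightarrow> ('o \<times> 'o \<Rightarrow> 'n) \<Rightarrow> bool" where
  "strong_multiplicative A C F \<phi> \<longleftrightarrow>
    is_functor A C F \<and>
    natural_iso (prod_cat A A) C
      (comp_ftor (prod_cat A A) (Tensor C) (prod_ftor A A F F))
      (comp_ftor (prod_cat A A) F (Tensor A)) \<phi> \<and>
    (\<forall>X\<in>Obj A. \<forall>Y\<in>Obj A. \<forall>Z\<in>Obj A.
      \<phi> (X \<odot>\<^bsub>A\<^esub> Y, Z) \<cdot>\<^bsub>C\<^esub> (\<phi> (X, Y) \<otimes>\<^bsub>C\<^esub> Id C (obmap F Z)) =
      \<phi> (X, Y \<odot>\<^bsub>A\<^esub> Z) \<cdot>\<^bsub>C\<^esub> (Id C (obmap F X) \<otimes>\<^bsub>C\<^esub> \<phi> (Y, Z)))"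

definition gentle ::
  "('o, 'm, 'y) cat_scheme \<Rightarrow> ('p, 'n, 'z) smcat_scheme \<Rightarrow> ('o, 'm, 'p, 'n) ftor \<Rightarrow> bool" where
  "gentle U C F \<longleftrightarrow> is_functor U C F \<and>
    fully_faithful (prod_cat U C) C
      (comp_ftor (prod_cat U C) (Tensor C) (prod_ftor U C F (id_ftor C))) \<and>
    fully_faithful (prod_cat C U) C
      (comp_ftor (prod_cat C U) (Tensor C) (prod_ftor C U (id_ftor C) F))"

definition terminal_smcat :: "(unit, unit) smcat" where
  "terminal_smcat = \<lparr>
    Obj = {()}, Arr = {()}, Dom = (\<lambda>_. ()), Cod = (\<lambda>_. ()), Id = (\<lambda>_. ()), Comp = (\<lambda>_ _. ()),
    Tensor = \<lparr>obmap = (\<lambda>_. ()), armap = (\<lambda>_. ())\<rparr>\<rparr>"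

lemma semi_monoidal_terminal: "semi_monoidal terminal_smcat"
  by unfold_locales
    (auto simp: terminal_smcat_def hom_def is_functor_def prod_cat_def PiE_def extensional_def)

lemma terminal_smcat_unique:
  fixes S :: "(unit, unit) smcat"
  assumes "cat.truncate S = cat.truncate terminal_smcat"
  shows "S = terminal_smcat"
  using assms by (cases S, cases "Tensor S") (auto simp: terminal_smcat_def cat.truncate_def fun_eq_iff)

end

theory Submission
  imports Defs
begin

text \<open>A functor \<open>* \<rightarrow> C\<close> is an object \<open>I\<close>, it is gentle iff \<open>I\<close> is cancellable, and \<open>\<phi>\<^sub>2\<close> is a single
  isomorphism \<open>\<alpha> : II \<rightarrow> I\<close>. So the only point is that the associativity of \<open>\<phi>\<^sub>2\<close> is automatic, i.e. that
  \<open>\<alpha> \<otimes> 1 = 1 \<otimes> \<alpha>\<close> for every Saavedra unit. Let \<open>\<lambda> : II \<rightarrow> I\<close> be the arrow with \<open>1 \<otimes> \<lambda> = \<alpha> \<otimes> 1\<close>. By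
  interchange,
  \<open>(\<alpha> \<otimes> 1)(1 \<otimes> 1 \<otimes> \<lambda>) = (1 \<otimes> \<lambda>)(\<alpha> \<otimes> 1 \<otimes> 1) = (\<alpha> \<otimes> 1)(\<alpha> \<otimes> 1 \<otimes> 1) = (\<alpha> \<otimes> 1)(1 \<otimes> \<lambda> \<otimes> 1)\<close>.
  Cancelling the isomorphism \<open>\<alpha> \<otimes> 1\<close> and then \<open>I\<close> on the left gives \<open>1 \<otimes> \<lambda> = \<lambda> \<otimes> 1\<close>, so
  \<open>\<alpha> \<otimes> 1 = \<lambda> \<otimes> 1\<close>, and cancelling \<open>I\<close> on the right gives \<open>\<alpha> = \<lambda>\<close>.\<close>

section \<open>Hom sets, identities and composites\<close>

lemma hom_arr: "f \<in> hom C X Y \<Longrightarrow> f \<in> Arr C"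
  by (simp add: hom_def)

context category
begin

lemma hom_obj:
  assumes "f \<in> hom C X Y"
  shows "X \<in> Obj C" "Y \<in> Obj C"
  using assms dom_obj cod_obj by (auto simp: hom_def)

lemma id_arr: "X \<in> Obj C \<Longrightarrow> Id C X \<in> Arr C"
  by (rule hom_arr[OF id_hom])

lemma comp_arr: "f \<in> hom C X Y \<Longrightarrow> g \<in> hom C Y Z \<Longrightarrow> g \<cdot> f \<in> Arr C"
  by (rule hom_arr[OF comp_hom])

end

section \<open>Product categories; composites and products of functors\<close>

lemma prod_cat_simps [simp]:
  "Obj (prod_cat A B) = Obj A \<times> Obj B"
  "Arr (prod_cat A B) = Arr A \<times> Arr B"
  "Id (prod_cat A B) (X, Y) = (Id A X, Id B Y)"
  "(g, g') \<cdot>\<^bsub>prod_cat A B\<^esub> (f, f') = (g \<cdot>\<^bsub>A\<^esub> f, g' \<cdot>\<^bsub>B\<^esub> f')"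
  by (simp_all add: prod_cat_def)

lemma hom_prod_cat [simp]:
  "hom (prod_cat A B) (X, X') (Y, Y') = hom A X Y \<times> hom B X' Y'"
  by (auto simp: hom_def prod_cat_def)

lemma category_prod:
  assumes "category A" "category B"
  shows "category (prod_cat A B)"
proof -
  interpret A: category A by fact
  interpret B: category B by fact
  show ?thesis
    by unfold_locales
      (auto simp: A.comp_assoc B.comp_assoc A.comp_id_left B.comp_id_left A.comp_id_right
        B.comp_id_right intro: A.id_hom B.id_hom A.comp_hom B.comp_hom,
       auto simp: prod_cat_def intro: A.dom_obj A.cod_obj B.dom_obj B.cod_obj)
qed

lemma functor_hom:
  "is_functor A B F \<Longrightarrow> X \<in> Obj A \<Longrightarrow> Y \<in> Obj A \<Longrightarrow> f \<in> hom A X Y \<Longrightarrow>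
    armap F f \<in> hom B (obmap F X) (obmap F Y)"
  by (simp add: is_functor_def)

lemma functor_comp:
  "is_functor A B F \<Longrightarrow> X \<in> Obj A \<Longrightarrow> Y \<in> Obj A \<Longrightarrow> Z \<in> Obj A \<Longrightarrow>
    f \<in> hom A X Y \<Longrightarrow> g \<in> hom A Y Z \<Longrightarrow> armap F (g \<cdot>\<^bsub>A\<^esub> f) = armap F g \<cdot>\<^bsub>B\<^esub> armap F f"
  unfolding is_functor_def by blast

lemma is_functor_comp:
  assumes "category A" "is_functor A B F" "is_functor B D G"
  shows "is_functor A D (comp_ftor A G F)"
proof -
  interpret A: category A by fact
  have ob: "obmap F \<in> Obj A \<rightarrow> Obj B" "obmap G \<in> Obj B \<rightarrow> Obj D"
    and ar: "armap F \<in> Arr A \<rightarrow> Arr B" "armap G \<in> Arr B \<rightarrow> Arr D"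
    using assms(2,3) by (auto simp: is_functor_def PiE_def)
  have obF: "obmap F X \<in> Obj B" if "X \<in> Obj A" for X
    using ob that by auto
  have "armap G (armap F (g \<cdot>\<^bsub>A\<^esub> f)) = armap G (armap F g) \<cdot>\<^bsub>D\<^esub> armap G (armap F f)"
    if "X \<in> Obj A" "Y \<in> Obj A" "Z \<in> Obj A" "f \<in> hom A X Y" "g \<in> hom A Y Z" for X Y Z f g
    using functor_comp[OF assms(2) that] that
      functor_comp[OF assms(3) obF obF obF functor_hom[OF assms(2)] functor_hom[OF assms(2)],
        of X Y Z f g]
    by simp
  then show ?thesis
    using assms(2,3) obF funcset_compose[OF ob] funcset_compose[OF ar] functor_comp[OF assms(2)]
    by (auto simp: is_functor_def comp_ftor_def compose_eq PiE_def A.id_arr A.comp_arr hom_arr)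
qed

lemma is_functor_prod:
  assumes "category A" "category A'" "is_functor A B F" "is_functor A' B' F'"
  shows "is_functor (prod_cat A A') (prod_cat B B') (prod_ftor A A' F F')"
proof -
  interpret A: category A by fact
  interpret A': category A' by fact
  show ?thesis
    using assms(3,4)
    by (auto simp: is_functor_def prod_ftor_def A.id_arr A'.id_arr A.comp_arr A'.comp_arr hom_arr)
qed

lemma (in category) is_functor_id: "is_functor C C (id_ftor C)"
  by (auto simp: is_functor_def id_ftor_def id_arr comp_arr hom_arr)

section \<open>Functors out of the terminal category\<close>

lemma terminal_smcat_simps [simp]:
  "Obj terminal_smcat = UNIV" "Arr terminal_smcat = UNIV" "hom terminal_smcat x y = UNIV"
  by (auto simp: terminal_smcat_def hom_def)

text \<open>The only arrow of the source is an identity, so the object determines the functor.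
  Extensionality imposes nothing, as objects and arrows fill the type \<open>unit\<close>.\<close>

lemma (in category) is_functor_terminal_iff:
  "is_functor terminal_smcat C F \<longleftrightarrow> obmap F () \<in> Obj C \<and> armap F () = Id C (obmap F ())"
proof -
  \<comment> \<open>The only composite in the source is the identity with itself.\<close>
  have "Id C X \<cdot> Id C X = Id C X" "Id C X \<in> Arr C" if "X \<in> Obj C" for X
    using comp_id_left[OF id_hom[OF that]] id_arr[OF that] by auto
  then show ?thesis
    by (auto simp: is_functor_def PiE_def extensional_def Pi_def id_hom)
qed

section \<open>Calculus of the tensor product\<close>

context semi_monoidal
begin

lemma tensor_obj: "X \<in> Obj C \<Longrightarrow> Y \<in> Obj C \<Longrightarrow> X \<odot> Y \<in> Obj C"
  using tensor_functor by (auto simp: is_functor_def)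

lemma tensor_hom:
  assumes "f \<in> hom C X Y" "g \<in> hom C X' Y'"
  shows "f \<otimes> g \<in> hom C (X \<odot> X') (Y \<odot> Y')"
proof -
  have "X \<in> Obj C" "Y \<in> Obj C" "X' \<in> Obj C" "Y' \<in> Obj C"
    using assms hom_obj by blast+
  then show ?thesis
    using tensor_functor assms by (simp add: is_functor_def)
qed

lemma tensor_id: "X \<in> Obj C \<Longrightarrow> Y \<in> Obj C \<Longrightarrow> Id C X \<otimes> Id C Y = Id C (X \<odot> Y)"
  using tensor_functor by (simp add: is_functor_def)

text \<open>Functoriality of the tensor on a composite in \<open>prod_cat C C\<close>.\<close>

lemma interchange:
  assumes "f \<in> hom C X Y" "g \<in> hom C Y Z" "f' \<in> hom C X' Y'" "g' \<in> hom C Y' Z'"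
  shows "(g \<otimes> g') \<cdot> (f \<otimes> f') = (g \<cdot> f) \<otimes> (g' \<cdot> f')"
proof -
  have "X \<in> Obj C" "Y \<in> Obj C" "X' \<in> Obj C" "Y' \<in> Obj C" "Z \<in> Obj C" "Z' \<in> Obj C"
    using assms hom_obj by blast+
  then show ?thesis
    using functor_comp[OF tensor_functor, of "(X, X')" "(Y, Y')" "(Z, Z')" "(f, f')" "(g, g')"] assms
    by simp
qed

section \<open>Tensoring with a fixed object, and gentleness\<close>

lemma is_functor_left_tensor:
  assumes "I \<in> Obj C"
  shows "is_functor C C (left_tensor C I)"
proof -
  note I = id_hom[OF assms]
  have "Id C I \<otimes> (g \<cdot> f) = (Id C I \<otimes> g) \<cdot> (Id C I \<otimes> f)"
    if "f \<in> hom C X Y" "g \<in> hom C Y Z" for f g X Y Z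
    using interchange[OF I I that] comp_id_left[OF I] by simp
  moreover have "Id C I \<otimes> f \<in> Arr C" if "f \<in> Arr C" for f
    using tensor_hom[OF I, of f] that by (auto simp: hom_def)
  ultimately show ?thesis
    using tensor_hom[OF I]
    by (auto simp: is_functor_def left_tensor_def tensor_id tensor_obj id_arr comp_arr hom_arr assms)
qed

lemma is_functor_right_tensor:
  assumes "I \<in> Obj C"
  shows "is_functor C C (right_tensor C I)"
proof -
  note I = id_hom[OF assms]
  have "(g \<cdot> f) \<otimes> Id C I = (g \<otimes> Id C I) \<cdot> (f \<otimes> Id C I)"
    if "f \<in> hom C X Y" "g \<in> hom C Y Z" for f g X Y Z
    using interchange[OF that I I] comp_id_left[OF I] by simp
  moreover have "f \<otimes> Id C I \<in> Arr C" if "f \<in> Arr C" for f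
    using tensor_hom[OF _ I, of f] that by (auto simp: hom_def)
  ultimately show ?thesis
    using tensor_hom[OF _ I]
    by (auto simp: is_functor_def right_tensor_def tensor_id tensor_obj id_arr comp_arr hom_arr assms)
qed

text \<open>Pairing with the unique arrow of the terminal category is bijective on hom sets and
  turns the two functors of gentleness into tensoring with \<open>I\<close> on the left and on the
  right.\<close>

lemma gentle_terminal_iff:
  assumes F: "is_functor terminal_smcat C F"
  shows "gentle terminal_smcat C F \<longleftrightarrow> cancellable C (obmap F ())"
proof -
  define I where "I = obmap F ()"
  have I: "I \<in> Obj C" "armap F () = Id C I" and ob: "obmap F u = I" for u
    using F by (auto simp: is_functor_terminal_iff I_def)
  interpret T: semi_monoidal terminal_smcat by (rule semi_monoidal_terminal)
  let ?L = "comp_ftor (prod_cat terminal_smcat C) (Tensor C) (prod_ftor terminal_smcat C F (id_ftor C))"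
  let ?R = "comp_ftor (prod_cat C terminal_smcat) (Tensor C) (prod_ftor C terminal_smcat (id_ftor C) F)"
  note cats = T.category_axioms category_axioms
  have "is_functor (prod_cat terminal_smcat C) C ?L"
    by (rule is_functor_comp[OF category_prod is_functor_prod tensor_functor])
      (fact cats F is_functor_id)+
  moreover have "bij_betw (armap ?L) (hom (prod_cat terminal_smcat C) ((), X) ((), Y)) B \<longleftrightarrow>
      bij_betw (armap (left_tensor C I)) (hom C X Y) B" for X Y B
  proof -
    have "bij_betw (Pair ()) (hom C X Y) (hom (prod_cat terminal_smcat C) ((), X) ((), Y))"
      by (auto simp: bij_betw_def inj_on_def image_iff)
    from bij_betw_comp_iff[OF this, of "armap ?L" B]
    have "bij_betw (armap ?L) (hom (prod_cat terminal_smcat C) ((), X) ((), Y)) B \<longleftrightarrow>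
        bij_betw (armap ?L \<circ> Pair ()) (hom C X Y) B" .
    also have "\<dots> \<longleftrightarrow> bij_betw (armap (left_tensor C I)) (hom C X Y) B"
      by (rule bij_betw_cong)
        (auto simp: comp_ftor_def compose_def prod_ftor_def id_ftor_def left_tensor_def I hom_def)
    finally show ?thesis .
  qed
  moreover have "obmap ?L ((), X) = obmap (left_tensor C I) X" if "X \<in> Obj C" for X
    using that by (simp add: comp_ftor_def compose_def prod_ftor_def id_ftor_def left_tensor_def ob)
  \<comment> \<open>\<open>hom_prod_cat\<close> is disabled so that the hom sets of the product keep
    the form in which the equivalence above rewrites them.\<close>
  ultimately have L: "fully_faithful (prod_cat terminal_smcat C) C ?L \<longleftrightarrow>
      fully_faithful C C (left_tensor C I)"
    using is_functor_left_tensor[OF I(1)]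
    by (simp add: fully_faithful_def del: hom_prod_cat)
  have "is_functor (prod_cat C terminal_smcat) C ?R"
    by (rule is_functor_comp[OF category_prod is_functor_prod tensor_functor])
      (fact cats F is_functor_id)+
  moreover have "bij_betw (armap ?R) (hom (prod_cat C terminal_smcat) (X, ()) (Y, ())) B \<longleftrightarrow>
      bij_betw (armap (right_tensor C I)) (hom C X Y) B" for X Y B
  proof -
    have "bij_betw (\<lambda>f. (f, ())) (hom C X Y) (hom (prod_cat C terminal_smcat) (X, ()) (Y, ()))"
      by (auto simp: bij_betw_def inj_on_def image_iff)
    from bij_betw_comp_iff[OF this, of "armap ?R" B]
    have "bij_betw (armap ?R) (hom (prod_cat C terminal_smcat) (X, ()) (Y, ())) B \<longleftrightarrow>
        bij_betw (armap ?R \<circ> (\<lambda>f. (f, ()))) (hom C X Y) B" .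
    also have "\<dots> \<longleftrightarrow> bij_betw (armap (right_tensor C I)) (hom C X Y) B"
      by (rule bij_betw_cong)
        (auto simp: comp_ftor_def compose_def prod_ftor_def id_ftor_def right_tensor_def I hom_def)
    finally show ?thesis .
  qed
  moreover have "obmap ?R (X, ()) = obmap (right_tensor C I) X" if "X \<in> Obj C" for X
    using that by (simp add: comp_ftor_def compose_def prod_ftor_def id_ftor_def right_tensor_def ob)
  ultimately have R: "fully_faithful (prod_cat C terminal_smcat) C ?R \<longleftrightarrow>
      fully_faithful C C (right_tensor C I)"
    using is_functor_right_tensor[OF I(1)]
    by (simp add: fully_faithful_def del: hom_prod_cat)
  show ?thesis
    using F L R I(1) by (simp add: gentle_def cancellable_def I_def)
qed

section \<open>Cancellation, and the commutation law of a Saavedra unit\<close>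

lemma cancellable_bij:
  assumes "cancellable C I" "X \<in> Obj C" "Y \<in> Obj C"
  shows "bij_betw (\<lambda>f. Id C I \<otimes> f) (hom C X Y) (hom C (I \<odot> X) (I \<odot> Y))"
    and "bij_betw (\<lambda>f. f \<otimes> Id C I) (hom C X Y) (hom C (X \<odot> I) (Y \<odot> I))"
proof -
  have "bij_betw (armap (left_tensor C I)) (hom C X Y) (hom C (I \<odot> X) (I \<odot> Y))"
    "bij_betw (armap (right_tensor C I)) (hom C X Y) (hom C (X \<odot> I) (Y \<odot> I))"
    using assms by (auto simp: cancellable_def fully_faithful_def left_tensor_def right_tensor_def)
  \<comment> \<open>On a hom set the restrictions built into the two functors are invisible.\<close>
  moreover have "armap (left_tensor C I) f = Id C I \<otimes> f" "armap (right_tensor C I) f = f \<otimes> Id C I"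
    if "f \<in> hom C X Y" for f
    using that by (auto simp: left_tensor_def right_tensor_def hom_def)
  ultimately show "bij_betw (\<lambda>f. Id C I \<otimes> f) (hom C X Y) (hom C (I \<odot> X) (I \<odot> Y))"
    "bij_betw (\<lambda>f. f \<otimes> Id C I) (hom C X Y) (hom C (X \<odot> I) (Y \<odot> I))"
    using bij_betw_cong by (smt (verit))+
qed

lemma iso_cancel:
  assumes "iso C e Y Z" "f \<in> hom C X Y" "g \<in> hom C X Y" "e \<cdot> f = e \<cdot> g"
  shows "f = g"
proof -
  obtain d where d: "d \<in> hom C Z Y" "d \<cdot> e = Id C Y" and e: "e \<in> hom C Y Z"
    using assms(1) by (auto simp: iso_def)
  show ?thesis
    using comp_assoc[OF assms(2) e d(1)] comp_assoc[OF assms(3) e d(1)] d(2) assms(4)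
      comp_id_left[OF assms(2)] comp_id_left[OF assms(3)] by simp
qed

lemma iso_tensor_id:
  assumes "iso C f X Y" "Z \<in> Obj C"
  shows "iso C (f \<otimes> Id C Z) (X \<odot> Z) (Y \<odot> Z)"
proof -
  obtain g where f: "f \<in> hom C X Y" and g: "g \<in> hom C Y X" and gf: "g \<cdot> f = Id C X" "f \<cdot> g = Id C Y"
    using assms(1) by (auto simp: iso_def)
  have XY: "X \<in> Obj C" "Y \<in> Obj C"
    using f hom_obj by blast+
  note Z = id_hom[OF assms(2)]
  have "(g \<otimes> Id C Z) \<cdot> (f \<otimes> Id C Z) = Id C (X \<odot> Z)" "(f \<otimes> Id C Z) \<cdot> (g \<otimes> Id C Z) = Id C (Y \<odot> Z)"
    using interchange[OF f g Z Z] interchange[OF g f Z Z] comp_id_left[OF Z] gf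
      tensor_id[OF XY(1) assms(2)] tensor_id[OF XY(2) assms(2)] by simp_all
  then show ?thesis
    using tensor_hom[OF f Z] tensor_hom[OF g Z] by (auto simp: iso_def)
qed

lemma saavedra_unit_commutes:
  assumes "saavedra_unit C I \<alpha>"
  shows "\<alpha> \<otimes> Id C I = Id C I \<otimes> \<alpha>"
proof -
  have c: "cancellable C I" and \<alpha>: "iso C \<alpha> (I \<odot> I) I"
    using assms by (auto simp: saavedra_unit_def)
  then have I: "I \<in> Obj C" and \<alpha>h: "\<alpha> \<in> hom C (I \<odot> I) I"
    by (auto simp: cancellable_def iso_def)
  note II = tensor_obj[OF I I]
  note i = id_hom[OF I] and ii = id_hom[OF II]
  note arrs = hom_arr[OF i] hom_arr[OF \<alpha>h]
  note assoc = tensor_obj_assoc[OF I I I]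
  \<comment> \<open>Strict associativity on objects gives this arrow the source
    \<open>I \<odot> (I \<odot> I)\<close>, so fullness of tensoring with \<open>I\<close> on the
    left yields \<open>l\<close>, the arrow \<lambda> of the overview.\<close>
  have ai: "\<alpha> \<otimes> Id C I \<in> hom C (I \<odot> I \<odot> I) (I \<odot> I)"
    using tensor_hom[OF \<alpha>h i] assoc by simp
  then have "\<alpha> \<otimes> Id C I \<in> (\<lambda>f. Id C I \<otimes> f) ` hom C (I \<odot> I) I"
    using cancellable_bij(1)[OF c II I] by (simp add: bij_betw_def)
  then obtain l where l: "l \<in> hom C (I \<odot> I) I" "Id C I \<otimes> l = \<alpha> \<otimes> Id C I"
    by auto
  have il: "Id C I \<otimes> l \<in> hom C (I \<odot> I \<odot> I) (I \<odot> I)"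
    using tensor_hom[OF i l(1)] .
  have li: "l \<otimes> Id C I \<in> hom C (I \<odot> I \<odot> I) (I \<odot> I)"
    using tensor_hom[OF l(1) i] assoc by simp
  \<comment> \<open>Both sides equal \<open>\<alpha> \<otimes> l\<close>.\<close>
  have 1: "(\<alpha> \<otimes> Id C I) \<cdot> (Id C (I \<odot> I) \<otimes> l) = (Id C I \<otimes> l) \<cdot> (\<alpha> \<otimes> Id C (I \<odot> I))"
    using interchange[OF ii \<alpha>h l(1) i] interchange[OF \<alpha>h i ii l(1)]
      comp_id_left[OF \<alpha>h] comp_id_right[OF \<alpha>h] comp_id_left[OF l(1)] comp_id_right[OF l(1)] by simp
  \<comment> \<open>Rebracketing exposes \<open>\<alpha> \<otimes> Id C I\<close>, which is replaced
    by \<open>Id C I \<otimes> l\<close>.\<close>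
  have 2: "\<alpha> \<otimes> Id C (I \<odot> I) = Id C I \<otimes> l \<otimes> Id C I"
    using tensor_arr_assoc[OF arrs(2) arrs(1) arrs(1)] tensor_arr_assoc[OF arrs(1) hom_arr[OF l(1)] arrs(1)]
      tensor_id[OF I I] l(2) by simp
  have 3: "Id C (I \<odot> I) \<otimes> l = Id C I \<otimes> Id C I \<otimes> l"
    using tensor_arr_assoc[OF arrs(1) arrs(1) hom_arr[OF l(1)]] tensor_id[OF I I] by simp
  have "iso C (\<alpha> \<otimes> Id C I) (I \<odot> I \<odot> I) (I \<odot> I)"
    using iso_tensor_id[OF \<alpha> I] assoc by simp
  then have "Id C I \<otimes> Id C I \<otimes> l = Id C I \<otimes> l \<otimes> Id C I"
    by (rule iso_cancel[OF _ tensor_hom[OF i il] tensor_hom[OF i li]])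
      (use 1 2 3 l(2) in simp)
  \<comment> \<open>Faithfulness of tensoring with \<open>I\<close> on the left removes the outer
    factor.\<close>
  then have "Id C I \<otimes> l = l \<otimes> Id C I"
    using cancellable_bij(1)[OF c tensor_obj[OF I II] II] il li
    by (auto simp: bij_betw_def dest: inj_onD)
  then have "\<alpha> \<otimes> Id C I = l \<otimes> Id C I"
    using l(2) by simp
  then have "\<alpha> = l"
    using cancellable_bij(2)[OF c II I] \<alpha>h l(1) by (auto simp: bij_betw_def dest: inj_onD)
  then show ?thesis
    using l(2) by simp
qed

section \<open>Multiplicative functors from the terminal category, and the bijection\<close>

lemma strong_multiplicative_terminal_iff:
  assumes F: "is_functor terminal_smcat C F"
  defines "I \<equiv> obmap F ()"
  shows "strong_multiplicative terminal_smcat C F \<phi> \<longleftrightarrow>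
    iso C (\<phi> ((), ())) (I \<odot> I) I \<and>
    \<phi> ((), ()) \<cdot> (\<phi> ((), ()) \<otimes> Id C I) = \<phi> ((), ()) \<cdot> (Id C I \<otimes> \<phi> ((), ()))"
proof -
  have I: "I \<in> Obj C" "armap F () = Id C I"
    using F by (auto simp: is_functor_terminal_iff I_def)
  interpret T: semi_monoidal terminal_smcat by (rule semi_monoidal_terminal)
  let ?TT = "prod_cat terminal_smcat terminal_smcat"
  let ?P = "comp_ftor ?TT (Tensor C) (prod_ftor terminal_smcat terminal_smcat F F)"
  let ?Q = "comp_ftor ?TT F (Tensor terminal_smcat)"
  have functors: "is_functor ?TT C ?P" "is_functor ?TT C ?Q"
    by (rule is_functor_comp[OF category_prod[OF T.category_axioms T.category_axioms]
          is_functor_prod[OF T.category_axioms T.category_axioms F F] tensor_functor]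
        is_functor_comp[OF category_prod[OF T.category_axioms T.category_axioms]
          T.tensor_functor F])+
  have vals: "obmap ?P u = I \<odot> I" "obmap ?Q u = I" "armap ?P u = Id C (I \<odot> I)" "armap ?Q u = Id C I"
    for u
    by (cases u; simp add: comp_ftor_def compose_def prod_ftor_def I tensor_id I_def[symmetric])+
  \<comment> \<open>This is the whole of naturality: by \<open>vals\<close> both functors are
    constant and send the single arrow to an identity.\<close>
  have "Id C I \<cdot> a = a \<cdot> Id C (I \<odot> I)" if "iso C a (I \<odot> I) I" for a
    using that comp_id_left comp_id_right by (auto simp: iso_def)
  then show ?thesis
    using F functors
    by (auto simp: strong_multiplicative_def natural_iso_def vals I_def[symmetric] extensional_def)
qed

text \<open>The equation for \<open>armap F ()\<close> makes \<open>F\<close> recoverable from its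
  object, which yields the inverse of the assignment.\<close>

lemma strong_multiplicative_gentle_terminal_iff:
  "strong_multiplicative terminal_smcat C F \<phi> \<and> gentle terminal_smcat C F \<longleftrightarrow>
    armap F () = Id C (obmap F ()) \<and> saavedra_unit C (obmap F ()) (\<phi> ((), ()))"
proof (cases "is_functor terminal_smcat C F")
  case True
  \<comment> \<open>Associativity of \<open>\<phi>\<close> follows by composing the law of
    \<open>saavedra_unit_commutes\<close> with \<open>\<phi> ((), ())\<close>.\<close>
  then show ?thesis
    using gentle_terminal_iff[OF True] strong_multiplicative_terminal_iff[OF True, of \<phi>]
      saavedra_unit_commutes[of "obmap F ()" "\<phi> ((), ())"]
    by (auto simp: saavedra_unit_def is_functor_terminal_iff)
next
  case False
  \<comment> \<open>Both sides are false: each of them implies that \<open>F\<close> is a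
    functor.\<close>
  then show ?thesis
    by (auto simp: gentle_def is_functor_terminal_iff saavedra_unit_def cancellable_def)
qed

end

theorem corollary5p2:
  fixes C :: "('o, 'm) smcat"
  assumes "semi_monoidal C"
  shows "bij_betw (\<lambda>(\<eta>, \<phi>). (obmap \<eta> (), \<phi> ((), ())))
    {(\<eta>, \<phi>). strong_multiplicative terminal_smcat C \<eta> \<phi> \<and> gentle terminal_smcat C \<eta>}
    {(I, \<alpha>). saavedra_unit C I \<alpha>}"
proof -
  interpret semi_monoidal C by fact
  show ?thesis
    unfolding strong_multiplicative_gentle_terminal_iff
    \<comment> \<open>The inverse takes constant maps. A map on \<open>unit\<close> or
      \<open>unit \<times> unit\<close> is determined by its single value, so both round trips are
      identities.\<close>
    by (rule bij_betw_byWitness[where f' = "\<lambda>(I, \<alpha>).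
          (\<lparr>obmap = (\<lambda>_. I), armap = (\<lambda>_. Id C I)\<rparr>, \<lambda>_. \<alpha>)"])
      (auto simp: fun_eq_iff intro!: ftor.equality)
qed

end
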